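(* For every positive integer $m$, $d(m,m^2+m)\le 17$.
   Context: An integral point set in the $m$-dimensional Euclidean space $\mathbb{E}^m$ is a set of $n$ points in $\mathbb{E}^m$ whose pairwise Euclidean distances are all integers and which are not all contained in a common affine hyperplane of $\mathbb{E}^m$. Its diameter is the largest distance between two of its points. For integers $n\ge m+1$, $d(m,n)$ denotes the minimum possible diameter of an integral point set in $\mathbb{E}^m$ consisting of $n$ points. *)

theory Defs
  imports "HOL-Analysis.Analysis"
begin

definition integral_point_set :: "(real ^ 'm::finite) set \<Rightarrow> bool" where
  "integral_point_set S \<longleftrightarrow>
     finite S \<and>
     (\<forall>x\<in>S. \<forall>y\<in>S. dist x y \<in> \<int>) \<and>
     \<not> (\<exists>a b. a \<noteq> 0 \<and> S \<subseteq> {x. a \<bullet> x = b})"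

text \<open>
  The quantity \<open>d(m, n)\<close>, where \<open>m = CARD('m)\<close>. The infimum is taken in the extended
  reals so that it is \<open>\<infinity>\<close>, not a junk value, when there is no integral point set of
  \<open>n\<close> points; otherwise it is a minimum, see \<open>min_diameter_attained\<close>.
\<close>
definition min_diameter :: "'m::finite itself \<Rightarrow> nat \<Rightarrow> ereal" where
  "min_diameter _ n =
     (INF S \<in> {S :: (real ^ 'm) set. integral_point_set S \<and> card S = n}. ereal (diameter S))"

lemma integral_point_set_nonempty:
  fixes S :: "(real ^ 'm::finite) set"
  assumes "integral_point_set S"
  shows "S \<noteq> {}"
proof
  assume "S = {}"
  moreover have "(1 :: real ^ 'm) \<noteq> 0" by simp
  ultimately show False
    using assms unfolding integral_point_set_def by (metis empty_subsetI)
qed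

lemma diameter_eq_Max:
  fixes S :: "(real ^ 'm::finite) set"
  assumes "integral_point_set S"
  shows "diameter S = Max {dist x y | x y. x \<in> S \<and> y \<in> S}"
proof -
  have fin: "finite S" using assms by (simp add: integral_point_set_def)
  have ne: "S \<noteq> {}" using integral_point_set_nonempty[OF assms] .
  have eq: "{dist x y | x y. x \<in> S \<and> y \<in> S} = (\<lambda>(x, y). dist x y) ` (S \<times> S)"
    by auto
  have "diameter S = Sup ((\<lambda>(x, y). dist x y) ` (S \<times> S))"
    using ne by (simp add: diameter_def)
  also have "\<dots> = Max ((\<lambda>(x, y). dist x y) ` (S \<times> S))"
    by (rule cSup_eq_Max) (use fin ne in auto)
  finally show ?thesis by (simp add: eq)
qed

lemma diameter_integral_point_set_Nats:
  fixes S :: "(real ^ 'm::finite) set"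
  assumes "integral_point_set S"
  shows "diameter S \<in> \<nat>"
proof -
  have fin: "finite S" using assms by (simp add: integral_point_set_def)
  have ne: "S \<noteq> {}" using integral_point_set_nonempty[OF assms] .
  have eq: "{dist x y | x y. x \<in> S \<and> y \<in> S} = (\<lambda>(x, y). dist x y) ` (S \<times> S)"
    by auto
  have "Max {dist x y | x y. x \<in> S \<and> y \<in> S} \<in> {dist x y | x y. x \<in> S \<and> y \<in> S}"
    unfolding eq by (rule Max_in) (use fin ne in auto)
  then obtain x y where "x \<in> S" "y \<in> S" "diameter S = dist x y"
    by (auto simp: diameter_eq_Max[OF assms])
  then show ?thesis
    using assms by (auto simp: integral_point_set_def Nats_altdef2)
qed

lemma min_diameter_attained:
  assumes "\<exists>S :: (real ^ 'm::finite) set. integral_point_set S \<and> card S = n"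
  shows "\<exists>S :: (real ^ 'm) set. integral_point_set S \<and> card S = n \<and>
           min_diameter TYPE('m) n = ereal (diameter S) \<and>
           (\<forall>T :: (real ^ 'm) set. integral_point_set T \<and> card T = n \<longrightarrow>
              diameter S \<le> diameter T)"
proof -
  let ?P = "\<lambda>S :: (real ^ 'm) set. integral_point_set S \<and> card S = n"
  obtain S0 where S0: "?P S0" using assms by blast
  obtain S where S: "?P S"
    and le: "\<And>T. ?P T \<Longrightarrow> nat \<lfloor>diameter S\<rfloor> \<le> nat \<lfloor>diameter T\<rfloor>"
    using ex_has_least_nat[of ?P S0 "\<lambda>S. nat \<lfloor>diameter S\<rfloor>", OF S0] by auto
  have min: "diameter S \<le> diameter T" if "?P T" for T
  proof -
    have "diameter S \<in> \<nat>" "diameter T \<in> \<nat>"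
      using S that by (simp_all add: diameter_integral_point_set_Nats)
    then obtain i j :: nat where "diameter S = real i" "diameter T = real j"
      unfolding Nats_def by blast
    then show ?thesis using le[OF that] by simp
  qed
  have "min_diameter TYPE('m) n = ereal (diameter S)"
    unfolding min_diameter_def
  proof (rule antisym)
    show "(INF S \<in> {S. ?P S}. ereal (diameter S)) \<le> ereal (diameter S)"
      by (rule INF_lower) (use S in simp)
    show "ereal (diameter S) \<le> (INF S \<in> {S. ?P S}. ereal (diameter S))"
      by (rule INF_greatest) (use min in simp)
  qed
  with S min show ?thesis by blast
qed

end

theory Submission imports Defs begin

text \<open>
  Let \<open>v\<^sub>0, \<dots>, v\<^sub>m\<close> be the vertices of a regular simplex of edge length \<open>1\<close>, and take the
  \<open>m(m + 1)\<close> points \<open>15 v\<^sub>i + 8 v\<^sub>j\<close> with \<open>i \<noteq> j\<close>. By polarization the squared distance of two of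
  them depends only on which indices coincide, and it is one of \<open>15\<^sup>2\<close>, \<open>8\<^sup>2\<close>,
  \<open>(15 - 8)\<^sup>2 = 7\<^sup>2\<close>, \<open>15\<^sup>2 - 15 \<cdot> 8 + 8\<^sup>2 = 13\<^sup>2\<close> and \<open>15\<^sup>2 + 8\<^sup>2 = 17\<^sup>2\<close>.
\<close>

text \<open>
  The vertices are the unit vectors together with the multiple \<open>t (1, \<dots>, 1)\<close> that lies at
  distance \<open>\<surd>2\<close> from each of them, i.e. \<open>m t\<^sup>2 - 2 t - 1 = 0\<close>; everything is scaled by \<open>1 / \<surd>2\<close>.
\<close>

definition simplex_vertex :: "'m::finite option \<Rightarrow> real ^ 'm" where
  "simplex_vertex p = (1 / sqrt 2) *\<^sub>R
     (case p of Some i \<Rightarrow> axis i 1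
      | None \<Rightarrow> ((1 + sqrt (real CARD('m) + 1)) / real CARD('m)) *\<^sub>R 1)"

definition simplex_pair_point :: "'m::finite option \<times> 'm option \<Rightarrow> real ^ 'm" where
  "simplex_pair_point = (\<lambda>(i, j). 15 *\<^sub>R simplex_vertex i + 8 *\<^sub>R simplex_vertex j)"

lemma inner_one_vec_one: "(1 :: real ^ 'm::finite) \<bullet> 1 = real CARD('m)"
  by (simp add: inner_vec_def)

lemma dist_simplex_vertex_sq:
  fixes i j :: "'m::finite option"
  shows "(dist (simplex_vertex i) (simplex_vertex j))\<^sup>2 = of_bool (i \<noteq> j)"
proof -
  define t where "t = (1 + sqrt (real CARD('m) + 1)) / real CARD('m)"
  have m: "real CARD('m) > 0"
    by simp
  have t: "real CARD('m) * t\<^sup>2 - 2 * t = 1"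
  proof -
    \<comment> \<open>Completing the square: \<open>t\<close> is the positive root of the quadratic,
      so \<open>m * t - 1\<close> squares to \<open>m + 1\<close>; expanding and cancelling
      \<open>m\<close> gives the claim.\<close>
    have "real CARD('m) * t = 1 + sqrt (real CARD('m) + 1)"
      using m by (simp add: t_def)
    then have "(real CARD('m) * t - 1)\<^sup>2 = real CARD('m) + 1"
      by simp
    then have "real CARD('m) * (real CARD('m) * t\<^sup>2 - 2 * t) = real CARD('m) * 1"
      by (simp add: power2_eq_square algebra_simps)
    then show ?thesis
      using m by (simp only: mult_cancel_left) simp
  qed
  have vertex: "simplex_vertex p =
      (1 / sqrt 2) *\<^sub>R (case p of Some i \<Rightarrow> axis i 1 | None \<Rightarrow> t *\<^sub>R 1)" for p :: "'m option"
    by (simp only: simplex_vertex_def t_def)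
  have scale: "(norm ((1 / sqrt 2) *\<^sub>R x - (1 / sqrt 2) *\<^sub>R y))\<^sup>2 = ((x - y) \<bullet> (x - y)) / 2"
    for x y :: "real ^ 'm"
    by (simp add: power_mult_distrib power_divide dot_square_norm flip: scaleR_right_diff_distrib)
  have axes: "(axis k 1 - axis l 1) \<bullet> (axis k 1 - axis l (1::real)) = 2"
    if "k \<noteq> l" for k l :: 'm
    using that by (simp add: inner_diff_left inner_diff_right inner_axis_axis)
  have apex: "(axis k (1::real) - t *\<^sub>R 1) \<bullet> (axis k 1 - t *\<^sub>R 1) = 2" for k :: 'm
    using t by (simp add: inner_diff_left inner_diff_right inner_axis inner_axis'
        inner_one_vec_one power2_eq_square algebra_simps)
  have apex': "(t *\<^sub>R 1 - axis k (1::real)) \<bullet> (t *\<^sub>R 1 - axis k 1) = 2" for k :: 'm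
    using apex[of k] by (simp add: inner_diff_left inner_diff_right algebra_simps)
  show ?thesis
    unfolding vertex dist_norm scale
    by (cases i; cases j) (auto simp: axes apex apex')
qed

text \<open>The cross term is \<open>2 * a * b\<close> times the inner product of
  \<open>x - z\<close> and \<open>y - w\<close>; polarization turns it into four squared
  distances.\<close>

lemma dist_combination_sq:
  fixes x y z w :: "'a::real_inner"
  shows "(dist (a *\<^sub>R x + b *\<^sub>R y) (a *\<^sub>R z + b *\<^sub>R w))\<^sup>2 =
    a\<^sup>2 * (dist x z)\<^sup>2 + b\<^sup>2 * (dist y w)\<^sup>2
    + a * b * ((dist x w)\<^sup>2 + (dist z y)\<^sup>2 - (dist x y)\<^sup>2 - (dist z w)\<^sup>2)"
  unfolding dist_norm power2_norm_eq_inner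
  by (simp add: inner_diff_left inner_diff_right inner_add_left inner_add_right inner_commute
      power2_eq_square algebra_simps)

lemma dist_simplex_pair_point:
  assumes "i \<noteq> j" and "k \<noteq> l"
  shows "dist (simplex_pair_point (i, j)) (simplex_pair_point (k, l)) \<in> {0, 7, 8, 13, 15, 17}"
    and "(i, j) \<noteq> (k, l) \<Longrightarrow> simplex_pair_point (i, j) \<noteq> simplex_pair_point (k, l)"
proof -
  let ?d = "dist (simplex_pair_point (i, j)) (simplex_pair_point (k, l))"
  \<comment> \<open>The \<open>- 2\<close> comes from \<open>i \<noteq> j\<close> and
    \<open>k \<noteq> l\<close>: both subtracted distances are 1.\<close>
  have sq: "?d\<^sup>2 = 225 * of_bool (i \<noteq> k) + 64 * of_bool (j \<noteq> l)
      + 120 * (of_bool (i \<noteq> l) + of_bool (k \<noteq> j) - 2)"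
    using assms
    by (simp add: simplex_pair_point_def dist_combination_sq dist_simplex_vertex_sq)
  \<comment> \<open>Only \<open>j = l\<close> gives 15, only \<open>i = k\<close> gives 8. If both
    differ, the value is 17, 13 or 7 as none, one or both of \<open>i = l\<close> and
    \<open>k = j\<close> hold.\<close>
  then have "?d\<^sup>2 \<in> {0\<^sup>2, 7\<^sup>2, 8\<^sup>2, 13\<^sup>2, 15\<^sup>2, 17\<^sup>2}"
    using assms by (auto simp: of_bool_def split: if_splits)
  then show "?d \<in> {0, 7, 8, 13, 15, 17}"
    by (simp only: insert_iff empty_iff power2_eq_iff_nonneg zero_le_dist zero_le_numeral order_refl)
  show "simplex_pair_point (i, j) \<noteq> simplex_pair_point (k, l)" if "(i, j) \<noteq> (k, l)"
  proof
    assume "simplex_pair_point (i, j) = simplex_pair_point (k, l)"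
    with sq that assms show False
      by (auto simp: of_bool_def split: if_splits)
  qed
qed

text \<open>The unit vectors force all coordinates of \<open>a\<close> to a common value
  \<open>d\<close>; the remaining vertex then gives \<open>d * sqrt (m + 1) = 0\<close>.\<close>

lemma simplex_vertices_not_in_hyperplane:
  fixes a :: "real ^ 'm::finite"
  assumes const: "\<And>p. a \<bullet> simplex_vertex p = c"
  shows "a = 0"
proof -
  define d where "d = sqrt 2 * c"
  have coord: "a $ i = d" for i
    using const[of "Some i"] by (simp add: simplex_vertex_def inner_axis d_def field_simps)
  then have a: "a = d *\<^sub>R 1"
    by (simp add: vec_eq_iff)
  have "d * (1 + sqrt (real CARD('m) + 1)) = d"
    using const[of None]
    by (simp add: simplex_vertex_def a inner_one_vec_one d_def field_simps)
  then have "d * sqrt (real CARD('m) + 1) = 0"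
    by (simp add: algebra_simps)
  moreover have "sqrt (real CARD('m) + 1) > 0"
    by (simp add: add_pos_pos)
  ultimately show ?thesis
    by (simp add: a)
qed

text \<open>Reduces to the vertices: subtracting the equations for \<open>(p, None)\<close> and
  \<open>(None, p)\<close> leaves \<open>15 - 8 = 7\<close> times the difference of
  \<open>a \<bullet> simplex_vertex p\<close> and \<open>a \<bullet> simplex_vertex None\<close>,
  which is thus 0.\<close>

lemma simplex_pair_points_not_in_hyperplane:
  fixes a :: "real ^ 'm::finite"
  assumes "\<And>i j. i \<noteq> j \<Longrightarrow> a \<bullet> simplex_pair_point (i, j) = b"
  shows "a = 0"
proof (rule simplex_vertices_not_in_hyperplane)
  fix p :: "'m option"
  show "a \<bullet> simplex_vertex p = a \<bullet> simplex_vertex None"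
  proof (cases "p = None")
    case False
    then show ?thesis
      using assms[of p None] assms[of None p, OF not_sym]
      by (simp add: simplex_pair_point_def inner_add_right)
  qed simp
qed

lemma card_off_diagonal:
  "card {(i, j). i \<noteq> (j :: 'a::finite)} = CARD('a) * (CARD('a) - 1)"
proof -
  have "{(i, j). i \<noteq> (j :: 'a)} = (SIGMA i:UNIV. UNIV - {i})"
    by auto
  then show ?thesis
    by (simp add: card_Diff_singleton)
qed

theorem theorem2:
  "min_diameter TYPE('m::finite) (CARD('m)\<^sup>2 + CARD('m)) \<le> 17"
proof -
  define I where "I = {(i, j). i \<noteq> (j :: 'm option)}"
  define S :: "(real ^ 'm) set" where "S = simplex_pair_point ` I"
  have dists: "dist x y \<in> {0, 7, 8, 13, 15, 17}" if "x \<in> S" "y \<in> S" for x y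
    using that dist_simplex_pair_point(1) unfolding S_def I_def by blast
  have "inj_on simplex_pair_point I"
    using dist_simplex_pair_point(2) unfolding inj_on_def I_def by blast
  then have "card S = card I"
    unfolding S_def by (rule card_image)
  also have "\<dots> = CARD('m)\<^sup>2 + CARD('m)"
    \<comment> \<open>The index type \<open>'m option\<close> has \<open>m + 1\<close> elements,
      hence \<open>(m + 1) * m\<close> ordered pairs.\<close>
    by (simp add: I_def card_off_diagonal card_UNIV_option power2_eq_square)
  finally have card: "card S = CARD('m)\<^sup>2 + CARD('m)" .
  have "a = 0" if "S \<subseteq> {x. a \<bullet> x = b}" for a b
    by (rule simplex_pair_points_not_in_hyperplane[of _ b]) (use that in \<open>auto simp: S_def I_def\<close>)
  moreover have "dist x y \<in> \<int>" if "x \<in> S" "y \<in> S" for x y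
    using dists[OF that] by auto
  ultimately have "integral_point_set S"
    unfolding integral_point_set_def by (auto simp: S_def)
  then have "min_diameter TYPE('m) (CARD('m)\<^sup>2 + CARD('m)) \<le> ereal (diameter S)"
    unfolding min_diameter_def by (intro INF_lower) (simp add: card)
  also have "diameter S \<le> 17"
    by (rule diameter_le) (use dists in \<open>fastforce simp: dist_norm\<close>)+
  finally show ?thesis
    by simp
qed

end
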